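(* Let $f:\mathbb{R}^d\to\mathbb{R}$ be differentiable and $(L_0,L_1)$-smooth with respect to a positive semi-definite matrix $\bm{H}\in\mathbb{R}^{d\times d}$, and let $\bm{S}_t\in\mathbb{R}^{d\times\ell}$, with columns $\bm{s}_1,\dots,\bm{s}_\ell$, be an oblivious $(\frac14,k,\delta)$-random sketching matrix with $k\ge4$ and $0<\delta<1$. Assume that the smoothing parameter $\alpha>0$ of the deterministic adaptive zeroth-order method satisfies $$\alpha^2\le\min\left\{\frac{1}{2L_1^2\zeta_1},\ \frac{3\|\nabla f(\bm{x}_t)\|^2}{8L_0^2\zeta_1}\right\},\qquad\zeta_1=\|\bm{H}\|^2\left(\frac{5\ell}{4}+\frac{d\ell}{4k}\right)^2.$$ Conditioned on the events $\mathcal{E}_{t,2}$ and $\mathcal{E}_{t,4}$ (defined in the context), it holds that $$\sigma_t\ge\frac{\alpha}{8\sqrt{\ell-1}}\|\nabla f(\bm{x}_t)\|.$$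
   Context: $\|\cdot\|$ is the Euclidean norm of vectors and the spectral norm of matrices, $\|\cdot\|_F$ the Frobenius norm; $\|\bm{x}\|_{\bm{H}}=\sqrt{\bm{x}^\top\bm{H}\bm{x}}$. $(L_0,L_1)$-smoothness w.r.t. $\bm{H}$: for all $\bm{x},\bm{y}\in\mathbb{R}^d$ with $\|\bm{y}-\bm{x}\|_{\bm{H}}\le 1/(L_1\sqrt{\|\bm{H}\|})$, $\big|f(\bm{y})-f(\bm{x})-\langle\nabla f(\bm{x}),\bm{y}-\bm{x}\rangle\big|\le\frac{L_0+L_1\|\nabla f(\bm{x})\|}{2}\|\bm{y}-\bm{x}\|_{\bm{H}}^2$. Oblivious $(\gamma,k,\delta)$-random sketching matrix: given a matrix $\bm{A}\in\mathbb{R}^{d\times d}$, a random $\bm{S}\in\mathbb{R}^{d\times\ell}$ independent of $\bm{A}$ such that, with probability at least $1-\delta$, $\|\bm{A}^\top\bm{S}\bm{S}^\top\bm{A}-\bm{A}^\top\bm{A}\|\le\gamma(\|\bm{A}\|^2+\|\bm{A}\|_F^2/k)$. Deterministic adaptive zeroth-order method: at iterate $\bm{x}_t$, with $\mathbf{g}(\bm{x}_t)=\sum_{i=1}^\ell\frac{f(\bm{x}_t+\alpha\bm{s}_i)-f(\bm{x}_t)}{\alpha}\bm{s}_i$ and $\sigma_t=\sqrt{\frac{1}{\ell-1}\sum_{j=1}^\ell\big(f(\bm{x}_t+\alpha\bm{s}_j)-\frac1\ell\sum_{i=1}^\ell f(\bm{x}_t+\alpha\bm{s}_i)\big)^2}$,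 update $\bm{x}_{t+1}=\bm{x}_t-\eta\,\mathbf{g}(\bm{x}_t)/\sigma_t$ with step size $\eta>0$. Events: $\mathcal{E}_{t,2}$: $(\frac34-\frac1k)\|\nabla f(\bm{x}_t)\|^2\le\nabla f(\bm{x}_t)^\top\bm{S}_t\bm{S}_t^\top\nabla f(\bm{x}_t)\le(\frac54+\frac1k)\|\nabla f(\bm{x}_t)\|^2$; $\mathcal{E}_{t,4}$: $\frac1\ell\big(\sum_{i=1}^\ell\langle\nabla f(\bm{x}_t),\bm{s}_i\rangle\big)^2\le\frac14\|\nabla f(\bm{x}_t)\|^2$.
   Formalization: The bound is proved on E_{t,2}, E_{t,4} and the event that the sketching inequality holds for A = I (probability at least 1-δ), since on E_{t,2} and E_{t,4} alone it can fail; L_0, L_1 are taken nonnegative and zero denominators impose no constraint. *)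

theory Defs
  imports "HOL-Probability.Probability"
begin

text \<open>
  The library's \<^const>\<open>norm\<close> on \<open>real^'n^'m\<close> is the Euclidean norm of the vector of rows,
  that is, the Frobenius norm. The spectral norm is the operator norm of the induced linear map.
\<close>

definition spectral_norm :: "real^'n^'m \<Rightarrow> real" where
  "spectral_norm A = onorm (\<lambda>v. A *v v)"

definition psd :: "real^'n^'n \<Rightarrow> bool" where
  "psd H \<longleftrightarrow> transpose H = H \<and> (\<forall>v. 0 \<le> v \<bullet> (H *v v))"

definition mat_norm :: "real^'n^'n \<Rightarrow> real^'n \<Rightarrow> real" where
  "mat_norm H v = sqrt (v \<bullet> (H *v v))"

definition grad :: "(real^'n \<Rightarrow> real) \<Rightarrow> real^'n \<Rightarrow> real^'n" where
  "grad f x = (THE D. GDERIV f x :> D)"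

text \<open>
  The radius condition \<open>mat_norm H (y - x) \<le> 1 / (L1 * sqrt (spectral_norm H))\<close> is multiplied
  out: for a positive denominator this is the same, and for a zero denominator the radius is
  infinite (with \<open>1 / 0 = 0\<close> it would be zero).
\<close>

definition L0_L1_smooth ::
  "(real^'n \<Rightarrow> real) \<Rightarrow> real \<Rightarrow> real \<Rightarrow> real^'n^'n \<Rightarrow> bool" where
  "L0_L1_smooth f L0 L1 H \<longleftrightarrow>
     (\<forall>x y. mat_norm H (y - x) * (L1 * sqrt (spectral_norm H)) \<le> 1 \<longrightarrow>
        \<bar>f y - f x - grad f x \<bullet> (y - x)\<bar>
          \<le> (L0 + L1 * norm (grad f x)) / 2 * (mat_norm H (y - x))\<^sup>2)"

definition sketch_event ::
  "'w measure \<Rightarrow> real \<Rightarrow> real \<Rightarrow> ('w \<Rightarrow> real^'l^'d) \<Rightarrow> real^'d^'d \<Rightarrow> 'w set" where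
  "sketch_event M \<gamma> k S A =
     {\<omega> \<in> space M.
        spectral_norm (transpose A ** S \<omega> ** transpose (S \<omega>) ** A - transpose A ** A)
          \<le> \<gamma> * ((spectral_norm A)\<^sup>2 + (norm A)\<^sup>2 / k)}"

text \<open>Obliviousness: the law of \<open>S\<close> is fixed before the matrix \<open>A\<close> is chosen.\<close>

definition oblivious_sketch ::
  "'w measure \<Rightarrow> real \<Rightarrow> real \<Rightarrow> real \<Rightarrow> ('w \<Rightarrow> real^'l^'d) \<Rightarrow> bool" where
  "oblivious_sketch M \<gamma> k \<delta> S \<longleftrightarrow>
     S \<in> borel_measurable M \<and>
     (\<forall>A. measure M (sketch_event M \<gamma> k S A) \<ge> 1 - \<delta>)"

definition zo_grad ::
  "(real^'d \<Rightarrow> real) \<Rightarrow> real \<Rightarrow> real^'l^'d \<Rightarrow> real^'d \<Rightarrow> real^'d" where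
  "zo_grad f \<alpha> S x =
     (\<Sum>i\<in>UNIV. ((f (x + \<alpha> *\<^sub>R column i S) - f x) / \<alpha>) *\<^sub>R column i S)"

definition zo_std ::
  "(real^'d \<Rightarrow> real) \<Rightarrow> real \<Rightarrow> real^'l^'d \<Rightarrow> real^'d \<Rightarrow> real" where
  "zo_std f \<alpha> S x =
     sqrt (1 / (real CARD('l) - 1) *
       (\<Sum>j\<in>UNIV. (f (x + \<alpha> *\<^sub>R column j S)
          - 1 / real CARD('l) * (\<Sum>i\<in>UNIV. f (x + \<alpha> *\<^sub>R column i S)))\<^sup>2))"

primrec zo_iterate ::
  "(real^'d \<Rightarrow> real) \<Rightarrow> real \<Rightarrow> real \<Rightarrow> real^'d \<Rightarrow> (nat \<Rightarrow> real^'l^'d) \<Rightarrow> nat \<Rightarrow> real^'d" where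
  "zo_iterate f \<alpha> \<eta> x0 S 0 = x0"
| "zo_iterate f \<alpha> \<eta> x0 S (Suc t) =
     zo_iterate f \<alpha> \<eta> x0 S t
       - (\<eta> / zo_std f \<alpha> (S t) (zo_iterate f \<alpha> \<eta> x0 S t))
           *\<^sub>R zo_grad f \<alpha> (S t) (zo_iterate f \<alpha> \<eta> x0 S t)"

definition event2 ::
  "'w measure \<Rightarrow> (real^'d \<Rightarrow> real) \<Rightarrow> real \<Rightarrow> ('w \<Rightarrow> real^'l^'d) \<Rightarrow> ('w \<Rightarrow> real^'d) \<Rightarrow> 'w set" where
  "event2 M f k S x =
     {\<omega> \<in> space M.
        (3/4 - 1/k) * (norm (grad f (x \<omega>)))\<^sup>2
          \<le> grad f (x \<omega>) \<bullet> ((S \<omega> ** transpose (S \<omega>)) *v grad f (x \<omega>)) \<and>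
        grad f (x \<omega>) \<bullet> ((S \<omega> ** transpose (S \<omega>)) *v grad f (x \<omega>))
          \<le> (5/4 + 1/k) * (norm (grad f (x \<omega>)))\<^sup>2}"

definition event4 ::
  "'w measure \<Rightarrow> (real^'d \<Rightarrow> real) \<Rightarrow> ('w \<Rightarrow> real^'l^'d) \<Rightarrow> ('w \<Rightarrow> real^'d) \<Rightarrow> 'w set" where
  "event4 M f S x =
     {\<omega> \<in> space M.
        1 / real CARD('l) * (\<Sum>i\<in>UNIV. grad f (x \<omega>) \<bullet> column i (S \<omega>))\<^sup>2
          \<le> 1/4 * (norm (grad f (x \<omega>)))\<^sup>2}"

text \<open>
  \<open>\<alpha>\<^sup>2 \<le> min (1 / (2 * L1\<^sup>2 * \<zeta>)) (3 * G\<^sup>2 / (8 * L0\<^sup>2 * \<zeta>))\<close> with both fractions multiplied out,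
  so that a zero denominator means no constraint.
\<close>

definition smoothing_bound :: "real \<Rightarrow> real \<Rightarrow> real \<Rightarrow> real \<Rightarrow> real \<Rightarrow> bool" where
  "smoothing_bound \<alpha> L0 L1 \<zeta> G \<longleftrightarrow>
     \<alpha>\<^sup>2 * (2 * L1\<^sup>2 * \<zeta>) \<le> 1 \<and> \<alpha>\<^sup>2 * (8 * L0\<^sup>2 * \<zeta>) \<le> 3 * G\<^sup>2"

end

(*
  Up to the factor 1/sqrt(l - 1), sigma_t is the norm of the centered vector of values
  f(x + alpha s_j). A first-order expansion splits this vector into alpha S^T g, with g the gradient,
  and a remainder of norm at most (0.66/sqrt l) alpha |g|: each column satisfies
  |s_j|^2 <= 5/4 + d/(4k), and the bound on alpha contains a factor l of which only sqrt l is needed.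
  The events give |centered S^T g| >= |g|/2, which is enough for l >= 4. For l = 2, 3 an oblivious
  sketch exists only if d <= l, and then its event at the identity improves the constant 1/2.
*)

theory Submission
  imports Defs
begin

section \<open>Spectral norms and quadratic forms\<close>

lemma spectral_norm_nonneg: "0 \<le> spectral_norm (A :: real^'n^'m)"
  unfolding spectral_norm_def by (rule onorm_pos_le[OF matrix_vector_mul_bounded_linear])

lemma norm_mult_vec_le_spectral_norm:
  "norm (A *v v) \<le> spectral_norm A * norm v" for A :: "real^'n^'m"
  unfolding spectral_norm_def by (rule onorm[OF matrix_vector_mul_bounded_linear])

lemma abs_inner_mult_vec_le_spectral_norm:
  "\<bar>v \<bullet> (A *v v)\<bar> \<le> spectral_norm A * (norm v)\<^sup>2" for A :: "real^'n^'n"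
proof -
  have "\<bar>v \<bullet> (A *v v)\<bar> \<le> norm v * norm (A *v v)"
    by (rule Cauchy_Schwarz_ineq2)
  also have "\<dots> \<le> norm v * (spectral_norm A * norm v)"
    by (intro mult_left_mono norm_mult_vec_le_spectral_norm) auto
  finally show ?thesis by (simp add: power2_eq_square mult_ac)
qed

lemma spectral_norm_mat_1: "spectral_norm (mat 1 :: real^'n^'n) \<le> 1"
  unfolding spectral_norm_def by (rule onorm_le) simp

lemma norm_mat_1_power2: "(norm (mat 1 :: real^'n^'n))\<^sup>2 = real CARD('n)"
  by (simp add: power2_norm_eq_inner inner_vec_def mat_def if_distrib cong: if_cong)

lemma vec_mult_nth: "(v v* S) $ j = v \<bullet> column j S"
  for S :: "real^'l^'d"
  by (simp add: vector_matrix_mult_def column_def inner_vec_def mult_ac)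

lemma inner_gram_eq_norm: "v \<bullet> ((S ** transpose S) *v v) = (norm (v v* S))\<^sup>2"
  for S :: "real^'l^'d"
  by (simp add: power2_norm_eq_inner dot_lmul_matrix flip: matrix_vector_mul_assoc)

lemma mat_norm_power2:
  assumes "psd H"
  shows "(mat_norm H v)\<^sup>2 = v \<bullet> (H *v v)"
  using assms by (auto simp: mat_norm_def psd_def)

lemma mat_norm_power2_le:
  assumes "psd H"
  shows "(mat_norm H v)\<^sup>2 \<le> spectral_norm H * (norm v)\<^sup>2"
  using abs_inner_mult_vec_le_spectral_norm[of v H] mat_norm_power2[OF assms, of v] by simp

section \<open>Centering and the sample deviation\<close>

text \<open>The orthogonal projection onto the complement of the constant vectors; hence linear,
  norm-nonincreasing and zero on constants.\<close>

definition centered :: "real^'n \<Rightarrow> real^'n" where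
  "centered v = (\<chi> i. v $ i - (\<Sum>j\<in>UNIV. v $ j) / real CARD('n))"

text \<open>Pythagoras: the subtracted term is the squared norm of the constant part of
  \<open>v\<close>. For \<open>v = g v* S\<close> it is the quantity that \<open>event4\<close>
  controls.\<close>

lemma norm_centered_power2:
  "(norm (centered v))\<^sup>2 = (norm v)\<^sup>2 - (\<Sum>j\<in>UNIV. v $ j)\<^sup>2 / real CARD('n)"
  for v :: "real^'n"
proof -
  define m where "m = (\<Sum>j\<in>UNIV. v $ j) / real CARD('n)"
  have m: "(\<Sum>j\<in>UNIV. v $ j) = m * real CARD('n)" by (simp add: m_def)
  have "(norm (centered v))\<^sup>2 = (\<Sum>i\<in>UNIV. (v $ i - m)\<^sup>2)"
    unfolding power2_norm_eq_inner inner_vec_def centered_def m_def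
    by (simp add: power2_eq_square)
  also have "\<dots> = (\<Sum>i\<in>UNIV. (v $ i)\<^sup>2 - 2 * m * v $ i + m\<^sup>2)"
    by (intro sum.cong) (auto simp: power2_diff)
  also have "\<dots> = (\<Sum>i\<in>UNIV. (v $ i)\<^sup>2) - 2 * m * (\<Sum>i\<in>UNIV. v $ i) + real CARD('n) * m\<^sup>2"
    by (simp add: sum.distrib sum_subtractf sum_distrib_left)
  also have "(\<Sum>i\<in>UNIV. (v $ i)\<^sup>2) = (norm v)\<^sup>2"
    by (simp add: power2_norm_eq_inner inner_vec_def flip: power2_eq_square)
  finally show ?thesis unfolding m by (simp add: power2_eq_square)
qed

lemma norm_centered_le: "norm (centered v) \<le> norm v"
  by (rule power2_le_imp_le) (simp_all add: norm_centered_power2)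

lemma centered_scaleR_add:
  "centered (c *\<^sub>R v + w) = c *\<^sub>R centered v + centered w"
  by (simp add: centered_def vec_eq_iff sum.distrib sum_distrib_left[symmetric] field_simps)

lemma centered_const_add: "centered ((\<chi> j. c) + v) = centered v"
  by (simp add: centered_def vec_eq_iff sum.distrib add_divide_distrib)

text \<open>The sum of squares under the root is the squared norm of the centered values. With a
  single column both sides are 0, by division by zero.\<close>

lemma zo_std_eq_norm_centered:
  "zo_std f \<alpha> S x =
     norm (centered (\<chi> j. f (x + \<alpha> *\<^sub>R column j S))) / sqrt (real CARD('l) - 1)"
  for S :: "real^'l^'d"
proof -
  let ?y = "\<chi> j. f (x + \<alpha> *\<^sub>R column j S)"
  have "(\<Sum>j\<in>UNIV. (f (x + \<alpha> *\<^sub>R column j S)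
          - 1 / real CARD('l) * (\<Sum>i\<in>UNIV. f (x + \<alpha> *\<^sub>R column i S)))\<^sup>2) = (norm (centered ?y))\<^sup>2"
    unfolding power2_norm_eq_inner inner_vec_def centered_def by (simp add: power2_eq_square)
  then show ?thesis by (simp add: zo_std_def real_sqrt_mult real_sqrt_divide)
qed

lemma norm_le_sqrt_card:
  fixes r :: "real^'l"
  assumes "\<And>j. \<bar>r $ j\<bar> \<le> b"
  shows "norm r \<le> sqrt (real CARD('l)) * b"
proof -
  \<comment> \<open>Index types are nonempty, so \<open>undefined\<close> serves as an
    index.\<close>
  have b: "0 \<le> b" using assms[of undefined] by linarith
  have "(norm r)\<^sup>2 = (\<Sum>j\<in>UNIV. \<bar>r $ j\<bar>\<^sup>2)"
    by (simp add: power2_norm_eq_inner inner_vec_def flip: power2_eq_square)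
  also have "\<dots> \<le> (\<Sum>j\<in>(UNIV::'l set). b\<^sup>2)"
    by (intro sum_mono power_mono assms) auto
  also have "\<dots> = (sqrt (real CARD('l)) * b)\<^sup>2" by (simp add: power_mult_distrib)
  finally show ?thesis by (rule power2_le_imp_le) (use b in simp)
qed

section \<open>What the sketch guarantee says about vectors\<close>

text \<open>The deviation is the quadratic form at \<open>v\<close> of the very matrix whose
  spectral norm is bounded.\<close>

lemma sketch_gram_deviation:
  fixes S :: "real^'l^'d"
  assumes "spectral_norm (transpose A ** S ** transpose S ** A - transpose A ** A) \<le> c"
  shows "\<bar>(norm ((A *v v) v* S))\<^sup>2 - (norm (A *v v))\<^sup>2\<bar> \<le> c * (norm v)\<^sup>2"
proof -
  let ?D = "transpose A ** S ** transpose S ** A - transpose A ** A"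
  have "v \<bullet> (?D *v v) = (norm ((A *v v) v* S))\<^sup>2 - (norm (A *v v))\<^sup>2"
  proof -
    have "v \<bullet> (transpose A *v w) = (A *v v) \<bullet> w" for w
      by (metis dot_lmul_matrix inner_commute transpose_matrix_vector transpose_transpose)
    moreover have "w \<bullet> (S *v u) = (w v* S) \<bullet> u" for w u
      by (metis dot_lmul_matrix transpose_matrix_vector)
    ultimately show ?thesis
      by (simp add: matrix_vector_mult_diff_rdistrib inner_diff_right power2_norm_eq_inner
          flip: matrix_vector_mul_assoc)
  qed
  then have "\<bar>(norm ((A *v v) v* S))\<^sup>2 - (norm (A *v v))\<^sup>2\<bar> \<le> spectral_norm ?D * (norm v)\<^sup>2"
    using abs_inner_mult_vec_le_spectral_norm[of v ?D] by simp
  also have "\<dots> \<le> c * (norm v)\<^sup>2" by (intro mult_right_mono assms) auto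
  finally show ?thesis .
qed

text \<open>The identity as test matrix controls all vectors \<open>v\<close> on a single event; the
  price is its squared Frobenius norm d, whence the term d/k.\<close>

lemma sketch_event_mat_1_deviation:
  fixes S :: "'w \<Rightarrow> real^'l^'d"
  assumes "\<omega> \<in> sketch_event M \<gamma> k S (mat 1)" and "0 \<le> \<gamma>"
  shows "\<bar>(norm (v v* S \<omega>))\<^sup>2 - (norm v)\<^sup>2\<bar>
           \<le> \<gamma> * (1 + real CARD('d) / k) * (norm v)\<^sup>2"
proof -
  have "(spectral_norm (mat 1 :: real^'d^'d))\<^sup>2 \<le> 1"
    using spectral_norm_mat_1[where 'n='d] spectral_norm_nonneg[of "mat 1 :: real^'d^'d"]
    by (simp add: power_le_one)
  then have "\<gamma> * ((spectral_norm (mat 1 :: real^'d^'d))\<^sup>2 + real CARD('d) / k)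
      \<le> \<gamma> * (1 + real CARD('d) / k)"
    using assms(2) by (intro mult_left_mono) auto
  with assms(1) have "spectral_norm (transpose (mat 1) ** S \<omega> ** transpose (S \<omega>) ** mat 1
      - transpose (mat 1) ** mat 1) \<le> \<gamma> * (1 + real CARD('d) / k)"
    unfolding sketch_event_def norm_mat_1_power2 by simp
  from sketch_gram_deviation[OF this, of v] show ?thesis by simp
qed

text \<open>Test the hypothesis on the column s itself: entry j of \<open>s v* S\<close> is |s|^2,
  so |s|^4 \<le> B |s|^2.\<close>

lemma norm_column_power2_le:
  fixes S :: "real^'l^'d"
  assumes "\<And>v. (norm (v v* S))\<^sup>2 \<le> B * (norm v)\<^sup>2" and "0 \<le> B"
  shows "(norm (column j S))\<^sup>2 \<le> B"
proof (cases "column j S = 0")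
  case False
  let ?s = "column j S"
  have "((norm ?s)\<^sup>2)\<^sup>2 = ((?s v* S) $ j)\<^sup>2"
    by (simp add: vec_mult_nth power2_norm_eq_inner)
  also have "\<dots> \<le> (norm (?s v* S))\<^sup>2"
    using component_le_norm_cart[of "?s v* S" j]
    by (metis abs_ge_zero power2_abs power_mono)
  also have "\<dots> \<le> B * (norm ?s)\<^sup>2" by (rule assms(1))
  finally have "(norm ?s)\<^sup>2 * (norm ?s)\<^sup>2 \<le> B * (norm ?s)\<^sup>2"
    by (simp only: power2_eq_square[of "(norm ?s)\<^sup>2"])
  moreover have "0 < (norm ?s)\<^sup>2" using False by simp
  ultimately show ?thesis by (rule mult_right_le_imp_le)
qed (use assms(2) in simp)

section \<open>Sketches with at most three columns\<close>

text \<open>Test matrices for the sketch: the Frobenius norm can be set through the rank, while the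
  spectral norm stays at most 1.\<close>

definition coord_proj :: "'d set \<Rightarrow> real^'d^'d" where
  "coord_proj J = (\<chi> i j. if i = j \<and> i \<in> J then 1 else 0)"

lemma coord_proj_mult_vec: "coord_proj J *v v = (\<chi> i. if i \<in> J then v $ i else 0)"
proof -
  have "(\<Sum>j\<in>UNIV. (if i = j \<and> i \<in> J then 1 else 0) * v $ j) = (if i \<in> J then v $ i else 0)" for i
    by (cases "i \<in> J") (simp_all add: if_distrib[of "\<lambda>a. a * _"] cong: if_cong)
  then show ?thesis by (simp add: coord_proj_def matrix_vector_mult_def vec_eq_iff)
qed

lemma spectral_norm_coord_proj: "spectral_norm (coord_proj J) \<le> 1"
  unfolding spectral_norm_def
proof (rule onorm_le)
  fix v :: "real^'a"
  have "norm (coord_proj J *v v) \<le> norm v"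
    by (intro norm_le_componentwise_cart) (simp add: coord_proj_mult_vec)
  then show "norm (coord_proj J *v v) \<le> 1 * norm v" by simp
qed

lemma norm_coord_proj_power2: "(norm (coord_proj J))\<^sup>2 = real (card J)"
proof -
  have "(\<Sum>j\<in>UNIV. (if i = j \<and> i \<in> J then 1 else (0::real)) * (if i = j \<and> i \<in> J then 1 else 0))
      = (if i \<in> J then 1 else 0)" for i
    by (cases "i \<in> J") (simp_all add: if_distrib[of "\<lambda>a. a * _"] cong: if_cong)
  then show ?thesis
    by (simp add: power2_norm_eq_inner inner_vec_def coord_proj_def sum.If_cases)
qed

text \<open>Dimension count: the coordinate subspace of \<open>J\<close> has dimension
  \<open>card J\<close>, too large to be mapped injectively into a space of dimension
  \<open>CARD('l)\<close>.\<close>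

lemma ex_kernel_vector_supported:
  fixes S :: "real^'l^'d"
  assumes "CARD('l) < card J"
  obtains v where "v \<noteq> 0" "coord_proj J *v v = v" "v v* S = 0"
proof -
  let ?V = "span ((\<lambda>i. axis i 1) ` J) :: (real^'d) set"
  have lin: "linear (\<lambda>v. v v* S)"
    by (simp flip: transpose_matrix_vector)
  have dimV: "dim ?V = card J"
  proof -
    have "independent ((\<lambda>i. axis i 1) ` J :: (real^'d) set)"
      by (rule independent_mono[OF independent_Basis]) (auto simp: Basis_vec_def)
    then have "dim ?V = card ((\<lambda>i. axis i 1) ` J :: (real^'d) set)"
      by (simp add: dim_span_eq_card_independent del: dim_span)
    then show ?thesis by (simp add: card_image inj_on_def axis_eq_axis)
  qed
  have "\<not> inj_on (\<lambda>v. v v* S) ?V"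
  proof
    assume "inj_on (\<lambda>v. v v* S) ?V"
    then have "dim ((\<lambda>v. v v* S) ` ?V) = card J"
      using dim_image_eq[OF lin] dimV by (simp add: span_span)
    then show False
      using assms dim_subset_UNIV_cart[of "(\<lambda>v. v v* S) ` ?V"] by simp
  qed
  then obtain v where v: "v \<in> ?V" "v \<noteq> 0" "v v* S = 0"
    using linear_injective_on_subspace_0[OF lin, of ?V] by auto
  have "coord_proj J *v w = w" if "w \<in> ?V" for w
    using that
  proof (induction rule: span_induct_alt)
    case base
    then show ?case by simp
  next
    case (step c x y)
    then have "coord_proj J *v x = x"
      by (auto simp: coord_proj_mult_vec vec_eq_iff axis_def)
    with step show ?case
      by (simp add: matrix_vector_right_distrib matrix_vector_mult_scaleR scalar_mult_eq_scaleR)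
  qed
  with v that show ?thesis by blast
qed

text \<open>
  A sketch with \<open>\<ell>\<close> columns annihilates a vector in the range of any coordinate projection of rank
  \<open>\<ell> + 1\<close>, and for such a projection the guarantee of the sketch is smaller than \<open>1\<close> if \<open>\<ell>\<close> is small.
\<close>

lemma oblivious_sketch_few_columns:
  fixes S :: "'w \<Rightarrow> real^'l^'d"
  assumes "oblivious_sketch M (1/4) k \<delta> S" and "4 \<le> k" and "\<delta> < 1" and "CARD('l) \<le> 3"
  shows "CARD('d) \<le> CARD('l)"
proof (rule ccontr)
  assume "\<not> CARD('d) \<le> CARD('l)"
  then obtain J :: "'d set" where J: "card J = CARD('l) + 1"
    by (metis not_less Suc_eq_plus1 Suc_leI obtain_subset_with_card_n)
  let ?A = "coord_proj J"
  \<comment> \<open>\<open>\<delta> < 1\<close> makes the event nonempty, and one realization of the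
    sketch suffices for the contradiction.\<close>
  have "measure M (sketch_event M (1/4) k S ?A) > 0"
    using assms(1,3) unfolding oblivious_sketch_def
    by (metis diff_gt_0_iff_gt less_le_trans)
  then obtain \<omega> where \<omega>: "\<omega> \<in> sketch_event M (1/4) k S ?A"
    by (metis all_not_in_conv less_irrefl measure_empty)
  have "(spectral_norm ?A)\<^sup>2 \<le> 1"
    using spectral_norm_coord_proj[of J] spectral_norm_nonneg[of ?A] by (simp add: power_le_one)
  \<comment> \<open>The squared Frobenius norm is l + 1 \<le> 4 \<le> k, so the guarantee becomes
    1/4 * (1 + 1) = 1/2.\<close>
  moreover have "(norm ?A)\<^sup>2 / k \<le> 1"
    using assms(2,4) J by (simp add: norm_coord_proj_power2 divide_le_eq)
  ultimately have "spectral_norm (transpose ?A ** S \<omega> ** transpose (S \<omega>) ** ?A - transpose ?A ** ?A) \<le> 1/2"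
    using \<omega> unfolding sketch_event_def by auto
  note dev = sketch_gram_deviation[OF this]
  obtain v where "v \<noteq> 0" "?A *v v = v" "v v* S \<omega> = 0"
    using ex_kernel_vector_supported[of J "S \<omega>"] J by auto
  \<comment> \<open>The deviation at \<open>v\<close> is the full |v|^2, yet it is at most half of
    that.\<close>
  with dev[of v] show False by simp
qed

section \<open>The first-order expansion and its remainder\<close>

text \<open>
  The constants: \<open>442/625 \<ge> sqrt (1/2)\<close>, \<open>49/80 \<ge> sqrt (3/8)\<close>, and their sum is at most \<open>33/25\<close>.
\<close>

lemma smoothing_error_le:
  fixes \<alpha> Z L0 L1 G :: real
  assumes "smoothing_bound \<alpha> L0 L1 (Z\<^sup>2) G" and "0 \<le> G"
  shows "\<alpha> * Z * (L0 + L1 * G) \<le> 33/25 * G"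
proof -
  have "(\<alpha> * L1 * Z)\<^sup>2 \<le> (442/625)\<^sup>2"
    using assms(1) by (simp add: smoothing_bound_def power_mult_distrib power2_eq_square mult_ac)
  then have 1: "\<alpha> * L1 * Z \<le> 442/625" by (rule power2_le_imp_le) simp
  have "8 * (\<alpha> * L0 * Z)\<^sup>2 \<le> 3 * G\<^sup>2"
    using assms(1) by (simp add: smoothing_bound_def power_mult_distrib mult_ac)
  moreover have "3/8 * G\<^sup>2 \<le> (49/80 * G)\<^sup>2"
    unfolding power_mult_distrib by (intro mult_right_mono) (simp_all add: power2_eq_square)
  ultimately have "(\<alpha> * L0 * Z)\<^sup>2 \<le> (49/80 * G)\<^sup>2" by linarith
  then have 2: "\<alpha> * L0 * Z \<le> 49/80 * G" by (rule power2_le_imp_le) (use assms(2) in simp)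
  have "\<alpha> * Z * (L0 + L1 * G) = \<alpha> * L0 * Z + \<alpha> * L1 * Z * G" by (simp add: algebra_simps)
  also have "\<dots> \<le> 49/80 * G + 442/625 * G"
    by (intro add_mono 2 mult_right_mono 1 assms(2))
  also have "\<dots> \<le> 33/25 * G" using assms(2) by simp
  finally show ?thesis .
qed

text \<open>Centering removes the constant \<open>f x\<close>, commutes with the linear part, and
  does not enlarge the remainder; the reverse triangle inequality then separates the two.\<close>

lemma zo_std_ge:
  fixes S :: "real^'l^'d"
  assumes "0 \<le> \<alpha>"
    and taylor: "\<And>j. \<bar>f (x + \<alpha> *\<^sub>R column j S) - f x - g \<bullet> (\<alpha> *\<^sub>R column j S)\<bar> \<le> e"
  shows "(\<alpha> * norm (centered (g v* S)) - sqrt (real CARD('l)) * e) / sqrt (real CARD('l) - 1)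
           \<le> zo_std f \<alpha> S x"
proof -
  define a where "a = g v* S"
  define r where "r = (\<chi> j. f (x + \<alpha> *\<^sub>R column j S) - f x - g \<bullet> (\<alpha> *\<^sub>R column j S))"
  have "(\<chi> j. f (x + \<alpha> *\<^sub>R column j S)) = (\<chi> j. f x) + (\<alpha> *\<^sub>R a + r)"
    by (simp add: vec_eq_iff a_def r_def vec_mult_nth)
  then have y: "centered (\<chi> j. f (x + \<alpha> *\<^sub>R column j S)) = \<alpha> *\<^sub>R centered a + centered r"
    by (simp only: centered_const_add centered_scaleR_add)
  have "norm (centered r) \<le> sqrt (real CARD('l)) * e"
    by (rule order_trans[OF norm_centered_le norm_le_sqrt_card]) (use taylor in \<open>simp add: r_def\<close>)
  moreover have "norm (\<alpha> *\<^sub>R centered a) = \<alpha> * norm (centered a)" using assms(1) by simp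
  ultimately have "\<alpha> * norm (centered a) - sqrt (real CARD('l)) * e
      \<le> norm (\<alpha> *\<^sub>R centered a + centered r)"
    using norm_diff_ineq[of "\<alpha> *\<^sub>R centered a" "centered r"] by linarith
  then show ?thesis
    unfolding zo_std_eq_norm_centered y a_def by (intro divide_right_mono) auto
qed

text \<open>The assumption \<open>radius\<close> is the squared radius condition of the smoothness.
  One factor \<open>spectral_norm H\<close> comes from comparing \<open>mat_norm H\<close> with the
  Euclidean norm, the other from the radius itself.\<close>

lemma smooth_error_le:
  assumes "L0_L1_smooth f L0 L1 H" and "psd H" and "0 \<le> L0" and "0 \<le> L1"
    and s: "(norm s)\<^sup>2 \<le> B"
    and radius: "\<alpha>\<^sup>2 * (L1\<^sup>2 * ((spectral_norm H)\<^sup>2 * B)) \<le> 1"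
  shows "\<bar>f (x + \<alpha> *\<^sub>R s) - f x - grad f x \<bullet> (\<alpha> *\<^sub>R s)\<bar>
           \<le> (L0 + L1 * norm (grad f x)) / 2 * (\<alpha>\<^sup>2 * (spectral_norm H * B))"
proof -
  let ?h = "spectral_norm H"
  have h: "0 \<le> ?h" by (rule spectral_norm_nonneg)
  have m: "(mat_norm H (\<alpha> *\<^sub>R s))\<^sup>2 \<le> \<alpha>\<^sup>2 * (?h * B)"
  proof -
    have "(mat_norm H (\<alpha> *\<^sub>R s))\<^sup>2 \<le> ?h * (norm (\<alpha> *\<^sub>R s))\<^sup>2"
      by (rule mat_norm_power2_le[OF assms(2)])
    also have "\<dots> = \<alpha>\<^sup>2 * (?h * (norm s)\<^sup>2)" by (simp add: power_mult_distrib)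
    also have "\<dots> \<le> \<alpha>\<^sup>2 * (?h * B)" by (intro mult_left_mono s h) auto
    finally show ?thesis .
  qed
  have "(mat_norm H (\<alpha> *\<^sub>R s) * (L1 * sqrt ?h))\<^sup>2 = (mat_norm H (\<alpha> *\<^sub>R s))\<^sup>2 * (L1\<^sup>2 * ?h)"
    using h by (simp add: power_mult_distrib)
  also have "\<dots> \<le> \<alpha>\<^sup>2 * (?h * B) * (L1\<^sup>2 * ?h)" by (intro mult_right_mono m) (use h in auto)
  also have "\<dots> \<le> 1\<^sup>2" using radius by (simp add: power2_eq_square mult_ac)
  finally have "mat_norm H (\<alpha> *\<^sub>R s) * (L1 * sqrt ?h) \<le> 1" by (rule power2_le_imp_le) simp
  then have "\<bar>f (x + \<alpha> *\<^sub>R s) - f x - grad f x \<bullet> (\<alpha> *\<^sub>R s)\<bar>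
      \<le> (L0 + L1 * norm (grad f x)) / 2 * (mat_norm H (\<alpha> *\<^sub>R s))\<^sup>2"
    using assms(1) unfolding L0_L1_smooth_def by (metis add_diff_cancel_left')
  also have "\<dots> \<le> (L0 + L1 * norm (grad f x)) / 2 * (\<alpha>\<^sup>2 * (?h * B))"
    by (intro mult_left_mono m) (use assms(3,4) in auto)
  finally show ?thesis .
qed

section \<open>The centered directional derivatives\<close>

text \<open>The factor on the left is what the final estimate consumes: 1/8 for the claim and 33/50
  / sqrt l for the remainder. It is at most 1/2 for l \<ge> 4 but exceeds 1/2 for l = 2, 3, hence
  the cases.\<close>

lemma centered_slopes_ge:
  fixes S :: "'w \<Rightarrow> real^'l^'d"
  assumes "oblivious_sketch M (1/4) k \<delta> S" and "4 \<le> k" and "\<delta> < 1"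
    and \<omega>: "\<omega> \<in> sketch_event M (1/4) k S (mat 1)"
      "\<omega> \<in> event2 M f k S x" "\<omega> \<in> event4 M f S x"
    and "CARD('l) \<noteq> 1"
  shows "(1/8 + 33/50 / sqrt (real CARD('l))) * norm (grad f (x \<omega>))
           \<le> norm (centered (grad f (x \<omega>) v* S \<omega>))"
proof -
  define g where "g = grad f (x \<omega>)"
  define a where "a = g v* S \<omega>"
  define n where "n = real CARD('l)"
  have "(\<Sum>j\<in>UNIV. a $ j)\<^sup>2 / n \<le> 1/4 * (norm g)\<^sup>2"
    using \<omega>(3) by (simp add: event4_def a_def g_def n_def vec_mult_nth)
  then have c: "(norm a)\<^sup>2 - 1/4 * (norm g)\<^sup>2 \<le> (norm (centered a))\<^sup>2"
    by (simp add: norm_centered_power2 n_def)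
  have concl: ?thesis if "b \<ge> 0" "b\<^sup>2 * (norm g)\<^sup>2 \<le> (norm (centered a))\<^sup>2" "1/8 + 33/50 / sqrt n \<le> b" for b
  proof -
    have "(1/8 + 33/50 / sqrt n) * norm g \<le> b * norm g" by (intro mult_right_mono that) auto
    also have "\<dots> \<le> norm (centered a)"
      by (rule power2_le_imp_le) (use that in \<open>auto simp: power_mult_distrib\<close>)
    finally show ?thesis by (simp add: g_def a_def n_def)
  qed
  \<comment> \<open>Here d \<le> l and k \<ge> 4 give d/k \<le> l/4. The event at the identity
    leaves 3/4 - l/16 of |g|^2, and the mean takes away at most 1/4.\<close>
  have small: "(1/2 - n/16) * (norm g)\<^sup>2 \<le> (norm (centered a))\<^sup>2" if "CARD('l) \<le> 3"
  proof -
    have "CARD('d) \<le> CARD('l)"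
      by (rule oblivious_sketch_few_columns[OF assms(1-3) that])
    then have "real CARD('d) / k \<le> n / 4"
      using assms(2) unfolding n_def by (intro frac_le) auto
    then have "1/4 * (1 + real CARD('d) / k) * (norm g)\<^sup>2 \<le> 1/4 * (1 + n/4) * (norm g)\<^sup>2"
      by (intro mult_right_mono) auto
    moreover have "(norm g)\<^sup>2 - (norm a)\<^sup>2 \<le> 1/4 * (1 + real CARD('d) / k) * (norm g)\<^sup>2"
      using sketch_event_mat_1_deviation[OF \<omega>(1), of g] unfolding a_def by linarith
    ultimately have "(1 - 1/4 * (1 + n/4)) * (norm g)\<^sup>2 \<le> (norm a)\<^sup>2" by (simp add: left_diff_distrib)
    with c show ?thesis by (simp add: algebra_simps)
  qed
  have "CARD('l) > 0" by simp
  then consider "CARD('l) = 2" | "CARD('l) = 3" | "CARD('l) \<ge> 4"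
    using assms(7) by linarith
  then show ?thesis
  proof cases
    case 1
    then have "3/8 * (norm g)\<^sup>2 \<le> (norm (centered a))\<^sup>2" using small by (simp add: n_def)
    \<comment> \<open>61/100 is a rational just below sqrt (3/8), still above 1/8 + 33/50 / sqrt
      2.\<close>
    then have "(61/100)\<^sup>2 * (norm g)\<^sup>2 \<le> (norm (centered a))\<^sup>2"
      by (rule order_trans[rotated]) (intro mult_right_mono, auto simp: power2_eq_square)
    moreover have "141/100 \<le> sqrt (2::real)" by (rule real_le_rsqrt) (simp add: power2_eq_square)
    then have "1/8 + 33/50 / sqrt n \<le> 61/100" using 1 by (simp add: n_def field_simps)
    ultimately show ?thesis by (intro concl[of "61/100"]) auto
  next
    case 2
    then have "5/16 * (norm g)\<^sup>2 \<le> (norm (centered a))\<^sup>2" using small by (simp add: n_def)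
    \<comment> \<open>55/100 lies between 1/8 + 33/50 / sqrt 3 and sqrt (5/16).\<close>
    then have "(55/100)\<^sup>2 * (norm g)\<^sup>2 \<le> (norm (centered a))\<^sup>2"
      by (rule order_trans[rotated]) (intro mult_right_mono, auto simp: power2_eq_square)
    moreover have "173/100 \<le> sqrt (3::real)" by (rule real_le_rsqrt) (simp add: power2_eq_square)
    then have "1/8 + 33/50 / sqrt n \<le> 55/100" using 2 by (simp add: n_def field_simps)
    ultimately show ?thesis by (intro concl[of "55/100"]) auto
  next
    case 3
    \<comment> \<open>\<open>event2\<close> leaves at least half of |g|^2, and \<open>event4\<close>
      takes away at most a quarter.\<close>
    have "1 / k \<le> 1/4" using assms(2) by simp
    then have "1/2 * (norm g)\<^sup>2 \<le> (3/4 - 1/k) * (norm g)\<^sup>2" by (intro mult_right_mono) auto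
    also have "\<dots> \<le> (norm a)\<^sup>2"
      using \<omega>(2) by (simp add: event2_def a_def g_def inner_gram_eq_norm)
    finally have "(1/2)\<^sup>2 * (norm g)\<^sup>2 \<le> (norm (centered a))\<^sup>2"
      using c by (simp add: power2_eq_square)
    moreover have "2 \<le> sqrt n" using 3 by (intro real_le_rsqrt) (simp add: n_def)
    then have "33/50 / sqrt n \<le> 33/50 / 2" by (intro divide_left_mono) (auto simp: n_def)
    then have "1/8 + 33/50 / sqrt n \<le> 1/2" by simp
    ultimately show ?thesis by (intro concl[of "1/2"]) auto
  qed
qed

section \<open>The lower bound on the sample deviation\<close>

theorem lemma9:
  fixes f :: "real^'d \<Rightarrow> real"
    and H :: "real^'d^'d"
    and M :: "'w measure"
    and S :: "nat \<Rightarrow> 'w \<Rightarrow> real^'l^'d"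
    and x :: "nat \<Rightarrow> 'w \<Rightarrow> real^'d"
    and x0 :: "real^'d"
    and L0 L1 k \<delta> \<alpha> \<eta> \<zeta>\<^sub>1 :: real
    and t :: nat
  assumes "\<forall>z. f differentiable (at z)"
    and "psd H"
    and "0 \<le> L0" and "0 \<le> L1"
    and "L0_L1_smooth f L0 L1 H"
    and "prob_space M"
    and "4 \<le> k" and "0 < \<delta>" and "\<delta> < 1"
    and "oblivious_sketch M (1/4) k \<delta> (S t)"
    and "0 < \<alpha>" and "0 < \<eta>"
    and "\<forall>s \<omega>. x s \<omega> = zo_iterate f \<alpha> \<eta> x0 (\<lambda>r. S r \<omega>) s"
    and "\<zeta>\<^sub>1 = (spectral_norm H)\<^sup>2 *
           (5 * real CARD('l) / 4 + real CARD('d) * real CARD('l) / (4 * k))\<^sup>2"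
  shows "measure M (sketch_event M (1/4) k (S t) (mat 1)) \<ge> 1 - \<delta> \<and>
    (\<forall>\<omega> \<in> sketch_event M (1/4) k (S t) (mat 1) \<inter> event2 M f k (S t) (x t) \<inter> event4 M f (S t) (x t).
       smoothing_bound \<alpha> L0 L1 \<zeta>\<^sub>1 (norm (grad f (x t \<omega>))) \<longrightarrow>
       zo_std f \<alpha> (S t \<omega>) (x t \<omega>)
         \<ge> \<alpha> / (8 * sqrt (real CARD('l) - 1)) * norm (grad f (x t \<omega>)))"
proof (intro conjI ballI impI)
  show "measure M (sketch_event M (1/4) k (S t) (mat 1)) \<ge> 1 - \<delta>"
    using assms(10) by (simp add: oblivious_sketch_def)
next
  fix \<omega>
  assume \<omega>: "\<omega> \<in> sketch_event M (1/4) k (S t) (mat 1) \<inter> event2 M f k (S t) (x t) \<inter> event4 M f (S t) (x t)"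
    and bound: "smoothing_bound \<alpha> L0 L1 \<zeta>\<^sub>1 (norm (grad f (x t \<omega>)))"
  define n where "n = real CARD('l)"
  define h where "h = spectral_norm H"
  \<comment> \<open>\<open>B\<close> is 1 plus the deviation 1/4 * (1 + d/k) at the identity, so it
    bounds the squared column norms; the bracket in \<open>\<zeta>\<^sub>1\<close> is
    \<open>n * B\<close>.\<close>
  define B where "B = 5/4 + real CARD('d) / (4 * k)"
  define G where "G = norm (grad f (x t \<omega>))"
  define T where "T = S t \<omega>"
  define e where "e = (L0 + L1 * G) / 2 * (\<alpha>\<^sup>2 * (h * B))"
  have n: "1 \<le> n" by (simp add: n_def Suc_leI)
  have B: "1 \<le> B" using \<open>4 \<le> k\<close> by (simp add: B_def add_increasing2)
  have Z: "\<zeta>\<^sub>1 = (h * n * B)\<^sup>2"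
    unfolding assms(14) h_def[symmetric] n_def[symmetric] B_def
    by (simp add: power_mult_distrib[symmetric] field_simps)
  have error: "\<alpha> * (h * n * B) * (L0 + L1 * G) \<le> 33/25 * G"
    using bound by (intro smoothing_error_le) (simp_all add: Z G_def)
  have gram: "(norm (v v* T))\<^sup>2 \<le> B * (norm v)\<^sup>2" for v
    using sketch_event_mat_1_deviation[of \<omega> M "1/4" k "S t" v] \<omega>
    by (simp add: T_def B_def algebra_simps)
  have column: "(norm (column j T))\<^sup>2 \<le> B" for j
    by (rule norm_column_power2_le[OF gram]) (use B in simp)
  \<comment> \<open>The smoothing bound contains \<open>B\<^sup>2 * n\<^sup>2\<close>, which
    dominates \<open>B\<close> because both \<open>B\<close> and \<open>n\<close> are at least
    1.\<close>
  have radius: "\<alpha>\<^sup>2 * (L1\<^sup>2 * (h\<^sup>2 * B)) \<le> 1"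
  proof -
    have "B * 1 \<le> B\<^sup>2 * n\<^sup>2"
      using B n by (intro mult_mono) (auto simp: self_le_power)
    then have "\<alpha>\<^sup>2 * (L1\<^sup>2 * (h\<^sup>2 * B)) \<le> \<alpha>\<^sup>2 * (L1\<^sup>2 * (h\<^sup>2 * (B\<^sup>2 * n\<^sup>2)))"
      by (intro mult_left_mono) auto
    also have "\<dots> \<le> 1"
    proof -
      let ?q = "\<alpha>\<^sup>2 * (L1\<^sup>2 * (h\<^sup>2 * (B\<^sup>2 * n\<^sup>2)))"
      have "2 * ?q \<le> 1"
        using bound unfolding smoothing_bound_def Z by (simp add: power_mult_distrib mult_ac)
      moreover have "0 \<le> ?q" by simp
      ultimately show ?thesis by linarith
    qed
    finally show ?thesis .
  qed
  show "zo_std f \<alpha> (S t \<omega>) (x t \<omega>)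
      \<ge> \<alpha> / (8 * sqrt (real CARD('l) - 1)) * norm (grad f (x t \<omega>))"
  proof (cases "CARD('l) = 1")
    \<comment> \<open>With one column both sides are 0: their denominators vanish.\<close>
    case True
    then show ?thesis by (simp add: zo_std_def)
  next
    case False
    have std: "(\<alpha> * norm (centered (grad f (x t \<omega>) v* T)) - sqrt n * e) / sqrt (n - 1)
        \<le> zo_std f \<alpha> T (x t \<omega>)"
      unfolding n_def
      by (rule zo_std_ge)
         (use \<open>0 < \<alpha>\<close> smooth_error_le[OF assms(5,2,3,4) column radius[unfolded h_def]]
          in \<open>auto simp: e_def h_def G_def\<close>)
    \<comment> \<open>The smoothing bound controls a product with a full factor \<open>n\<close>,
      while \<open>e\<close> has none; splitting it off turns \<open>sqrt n\<close> into
      \<open>1 / sqrt n\<close>. The identity is proved for arbitrary \<open>q > 0\<close> and used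
      at \<open>q = sqrt n\<close>.\<close>
    have "sqrt n * e = \<alpha> / (2 * sqrt n) * (\<alpha> * (h * n * B) * (L0 + L1 * G))"
    proof -
      have "q * e = \<alpha> / (2 * q) * (\<alpha> * (h * q\<^sup>2 * B) * (L0 + L1 * G))" if "0 < q" for q
        using that by (simp add: e_def field_simps power2_eq_square)
      from this[of "sqrt n"] show ?thesis using n by simp
    qed
    also have "\<dots> \<le> \<alpha> / (2 * sqrt n) * (33/25 * G)"
      using error \<open>0 < \<alpha>\<close> n by (intro mult_left_mono) auto
    \<comment> \<open>33/50 is half of 33/25, the other factor 1/2 being that of the smoothness
      inequality.\<close>
    finally have "\<alpha> / 8 * G + sqrt n * e \<le> \<alpha> * ((1/8 + 33/50 / sqrt n) * G)"
      by (simp add: algebra_simps)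
    also have "\<dots> \<le> \<alpha> * norm (centered (grad f (x t \<omega>) v* T))"
      using \<omega> False \<open>0 < \<alpha>\<close> centered_slopes_ge[OF assms(10,7,9)]
      by (intro mult_left_mono) (auto simp: n_def G_def T_def)
    finally have "\<alpha> / 8 * G / sqrt (n - 1)
        \<le> (\<alpha> * norm (centered (grad f (x t \<omega>) v* T)) - sqrt n * e) / sqrt (n - 1)"
      using n by (intro divide_right_mono) auto
    with std have "\<alpha> / 8 * G / sqrt (n - 1) \<le> zo_std f \<alpha> T (x t \<omega>)" by linarith
    then show ?thesis by (simp add: n_def G_def T_def)
  qed
qed


end
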